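(* Let $D_+,D_-$ be the $2n\times 2n$ derivative operators of the upwind semi-discrete Active Flux method, given by $$(D_\pm\mathbf u)_i=\frac{u_{i+1/2}-u_{i-1/2}}{\Delta x},\qquad (D_+\mathbf u)_{i+1/2}=\frac{-4u_{i+1/2}+6u_{i+1}-2u_{i+3/2}}{\Delta x},\qquad (D_-\mathbf u)_{i+1/2}=\frac{2u_{i-1/2}-6u_i+4u_{i+1/2}}{\Delta x}.$$ The symmetric matrix $M$ given by $$(M\mathbf u)_i=\Delta x\, m_v\left(-\tfrac12u_{i-1/2}+u_i-\tfrac12u_{i+1/2}\right),$$ $$(M\mathbf u)_{i+1/2}=\Delta x\, m_v\left(\tfrac16u_{i-1/2}-\tfrac12u_i+\tfrac23u_{i+1/2}-\tfrac12u_{i+1}+\tfrac16u_{i+3/2}\right)$$ is, up to a scalar factor $m_v\in\mathbb R$, the only symmetric real $2n\times2n$ matrix which is pentadiagonal (up to periodic boundary terms) and ensures that $D_+$ and $D_-$ are adjoint to each other with respect to $M$, in the sense that $MD_++D_-^TM=0$.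
   Context: Uniform periodic grid with $n$ cells of size $\Delta x>0$. The unknowns are cell averages $u_i$ and interface point values $u_{i+1/2}$, with $u_{i+n}=u_i$, $u_{i+n+1/2}=u_{i+1/2}$ (cell indices modulo $n$), collected in $\mathbf u=(u_{-1/2},u_0,u_{1/2},u_1,\dots,u_{n-3/2},u_{n-1})^T\in\mathbb R^{2n}$. For a $2n\times2n$ matrix $A$, $(A\mathbf u)_i$ and $(A\mathbf u)_{i+1/2}$ denote the components of $A\mathbf u$ at the positions of $u_i$ and $u_{i+1/2}$. "Pentadiagonal up to periodic boundary terms" means, with respect to this ordering, that the entry in row $k$ and column $l$ vanishes unless $k-l\in\{0,\pm1,\pm2\}$ modulo $2n$.
   Formalization: The uniqueness of M up to a scalar is claimed only for n ≥ 4 cells, as it fails for n = 1, 2, 3 (the matrix with ones at all cell-cell positions and zeros elsewhere is another solution); that M has the stated properties is claimed for all n ≥ 1. *)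

theory Defs
  imports "Jordan_Normal_Form.Matrix" "HOL-Number_Theory.Cong"
begin

text \<open>
  The unknowns are stored as (u_{-1/2}, u_0, u_{1/2}, u_1, ..., u_{n-3/2}, u_{n-1}), counted from
  position 0. Hence u_i is at position 2i+1 and u_{i+1/2} at position 2i+2, modulo the length 2n.
  The term \<open>cell_avg u i\<close> is u_i and \<open>point_val u i\<close> is u_{i+1/2}, for every integer i.
\<close>

definition cell_avg :: "real vec \<Rightarrow> int \<Rightarrow> real" where
  "cell_avg u i = u $ nat ((2 * i + 1) mod int (dim_vec u))"

definition point_val :: "real vec \<Rightarrow> int \<Rightarrow> real" where
  "point_val u i = u $ nat ((2 * i + 2) mod int (dim_vec u))"

text \<open>
  The 2n x 2n matrix A with (A u)_i = \<open>C u i\<close> and (A u)_{i+1/2} = \<open>P u i\<close>, for linear C and P;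
  column l is the image of the l-th unit vector. An even row k holds the point value with index
  (k-1)/2 = (k div 2 - 1) + 1/2. The lemmas below confirm that the matrices defined in this way
  act by the intended formulas.
\<close>

definition stencil_mat ::
  "nat \<Rightarrow> (real vec \<Rightarrow> int \<Rightarrow> real) \<Rightarrow> (real vec \<Rightarrow> int \<Rightarrow> real) \<Rightarrow> real mat" where
  "stencil_mat n C P = mat (2 * n) (2 * n) (\<lambda>(k, l).
     if odd k then C (unit_vec (2 * n) l) (int (k div 2))
     else P (unit_vec (2 * n) l) (int (k div 2) - 1))"

definition D_plus :: "nat \<Rightarrow> real \<Rightarrow> real mat" where
  "D_plus n dx = stencil_mat n
     (\<lambda>u i. (point_val u i - point_val u (i - 1)) / dx)
     (\<lambda>u i. (- 4 * point_val u i + 6 * cell_avg u (i + 1) - 2 * point_val u (i + 1)) / dx)"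

definition D_minus :: "nat \<Rightarrow> real \<Rightarrow> real mat" where
  "D_minus n dx = stencil_mat n
     (\<lambda>u i. (point_val u i - point_val u (i - 1)) / dx)
     (\<lambda>u i. (2 * point_val u (i - 1) - 6 * cell_avg u i + 4 * point_val u i) / dx)"

definition mass_mat :: "nat \<Rightarrow> real \<Rightarrow> real \<Rightarrow> real mat" where
  "mass_mat n dx mv = stencil_mat n
     (\<lambda>u i. dx * mv * (- 1/2 * point_val u (i - 1) + cell_avg u i - 1/2 * point_val u i))
     (\<lambda>u i. dx * mv * (1/6 * point_val u (i - 1) - 1/2 * cell_avg u i + 2/3 * point_val u i
                        - 1/2 * cell_avg u (i + 1) + 1/6 * point_val u (i + 1)))"

definition periodic_pentadiagonal :: "nat \<Rightarrow> real mat \<Rightarrow> bool" where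
  "periodic_pentadiagonal n A \<longleftrightarrow>
     (\<forall>k < 2 * n. \<forall>l < 2 * n.
        (\<forall>d \<in> {0, 1, -1, 2, -2}. \<not> [int k - int l = d] (mod 2 * int n)) \<longrightarrow> A $$ (k, l) = 0)"

text \<open>
  For n = 1, 2, 3 uniqueness up to a scalar fails: the matrix E with entry 1 in each row and column
  that belong to cell averages, and 0 elsewhere, is symmetric and pentadiagonal up to periodic
  boundary terms, since two cells are then always equal or neighbours. The values (D_+ u)_i
  sum to zero over i, and so do (D_- u)_i, so that E D_+ = 0 and D_-^T E = 0. The uniqueness claim therefore
  needs n >= 4.
\<close>

lemma stencil_mat_carrier: "stencil_mat n C P \<in> carrier_mat (2 * n) (2 * n)"
  by (simp add: stencil_mat_def)

lemma pos_less: "n > 0 \<Longrightarrow> nat (x mod (2 * int n)) < 2 * n"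
  by (simp add: nat_less_iff)

lemma sum_unit_vec:
  assumes "p < m"
  shows "(\<Sum>l<m. unit_vec m l $ p * u $ l) = (u $ p :: real)"
proof -
  have "(\<Sum>l<m. unit_vec m l $ p * u $ l) = (\<Sum>l<m. if p = l then u $ l else 0)"
    using assms by (intro sum.cong) (auto simp: unit_vec_def)
  then show ?thesis using assms by simp
qed

definition lin_fun :: "nat \<Rightarrow> (real vec \<Rightarrow> real) \<Rightarrow> bool" where
  "lin_fun n f \<longleftrightarrow>
     (\<forall>u \<in> carrier_vec (2 * n). (\<Sum>l<2 * n. f (unit_vec (2 * n) l) * u $ l) = f u)"

lemma lin_fun_cell_avg: "n > 0 \<Longrightarrow> lin_fun n (\<lambda>u. cell_avg u i)"
  unfolding lin_fun_def cell_avg_def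
  by (metis (no_types, lifting) carrier_vecD index_unit_vec(3) of_nat_mult of_nat_numeral pos_less
      sum.cong sum_unit_vec)

lemma lin_fun_point_val: "n > 0 \<Longrightarrow> lin_fun n (\<lambda>u. point_val u i)"
  unfolding lin_fun_def point_val_def
  by (metis (no_types, lifting) carrier_vecD index_unit_vec(3) of_nat_mult of_nat_numeral pos_less
      sum.cong sum_unit_vec)

lemma lin_fun_add: "lin_fun n f \<Longrightarrow> lin_fun n g \<Longrightarrow> lin_fun n (\<lambda>u. f u + g u)"
  by (simp add: lin_fun_def distrib_right sum.distrib)

lemma lin_fun_diff: "lin_fun n f \<Longrightarrow> lin_fun n g \<Longrightarrow> lin_fun n (\<lambda>u. f u - g u)"
  by (simp add: lin_fun_def left_diff_distrib sum_subtractf)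

lemma lin_fun_scale: "lin_fun n f \<Longrightarrow> lin_fun n (\<lambda>u. c * f u)"
  by (simp add: lin_fun_def mult.assoc flip: sum_distrib_left)

lemma lin_fun_divide: "lin_fun n f \<Longrightarrow> lin_fun n (\<lambda>u. f u / c)"
  by (simp add: lin_fun_def flip: sum_divide_distrib)

lemmas lin_fun_intros = lin_fun_divide lin_fun_scale lin_fun_add lin_fun_diff
  lin_fun_cell_avg lin_fun_point_val

lemma pos_periodic:
  fixes i c b :: int
  shows "(2 * (i mod int n + c) + b) mod (2 * int n) = (2 * (i + c) + b) mod (2 * int n)"
proof -
  have "2 * (i mod int n) mod (2 * int n) = 2 * i mod (2 * int n)"
    by simp
  then have "(2 * (i mod int n) + (2 * c + b)) mod (2 * int n) = (2 * i + (2 * c + b)) mod (2 * int n)"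
    by (metis mod_add_left_eq)
  then show ?thesis by (simp add: algebra_simps)
qed

lemma values_periodic:
  assumes "dim_vec u = 2 * n"
  shows "cell_avg u (i mod int n + c) = cell_avg u (i + c)"
    and "point_val u (i mod int n + c) = point_val u (i + c)"
  using assms pos_periodic[of i n c 1] pos_periodic[of i n c 2]
  by (simp_all add: cell_avg_def point_val_def)

lemma stencil_mat_row:
  assumes "k < 2 * n" "u \<in> carrier_vec (2 * n)"
  shows "(stencil_mat n C P *\<^sub>v u) $ k
           = (\<Sum>l<2 * n. (if odd k then C (unit_vec (2 * n) l) (int (k div 2))
                        else P (unit_vec (2 * n) l) (int (k div 2) - 1)) * u $ l)" (is "_ = ?rhs")
proof -
  have "(stencil_mat n C P *\<^sub>v u) $ k = (\<Sum>l<2 * n. stencil_mat n C P $$ (k, l) * u $ l)"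
    using assms by (auto simp: stencil_mat_def scalar_prod_def atLeast0LessThan intro!: sum.cong)
  also have "\<dots> = ?rhs"
    using assms by (intro sum.cong) (auto simp: stencil_mat_def)
  finally show ?thesis .
qed

lemma stencil_mat_action:
  assumes n: "n > 0" and u: "u \<in> carrier_vec (2 * n)"
    and C: "\<And>i. lin_fun n (\<lambda>u. C u i)" and P: "\<And>i. lin_fun n (\<lambda>u. P u i)"
    and C': "C u (i mod int n) = C u i" and P': "P u ((i + 1) mod int n - 1) = P u i"
  shows "cell_avg (stencil_mat n C P *\<^sub>v u) i = C u i"
    and "point_val (stencil_mat n C P *\<^sub>v u) i = P u i"
proof -
  have dim: "dim_vec (stencil_mat n C P *\<^sub>v u) = 2 * n"
    by (simp add: stencil_mat_def)
  have odd_pos: "odd k \<and> int (k div 2) = j" if "int k = 2 * j + 1" for k j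
    using that by presburger
  have even_pos: "\<not> odd k \<and> int (k div 2) = j" if "int k = 2 * j" for k j
    using that by presburger
  define k where "k = nat ((2 * i + 1) mod (2 * int n))"
  have k: "k < 2 * n" using pos_less[OF n] by (simp add: k_def)
  have "(2 * i + 1) mod (2 * int n) = 2 * (i mod int n) + 1"
    using pos_zmod_mult_2[of "int n" i] by (simp add: add.commute)
  moreover have "i mod int n \<ge> 0" using n by simp
  ultimately have "int k = 2 * (i mod int n) + 1" unfolding k_def by simp
  then have *: "odd k" "int (k div 2) = i mod int n" using odd_pos by blast+
  have "cell_avg (stencil_mat n C P *\<^sub>v u) i = (stencil_mat n C P *\<^sub>v u) $ k"
    by (simp only: cell_avg_def dim k_def of_nat_mult of_nat_numeral)
  also have "\<dots> = C u i"
    using C u C' * by (simp only: stencil_mat_row[OF k u] lin_fun_def not_False_eq_True if_True)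
  finally show "cell_avg (stencil_mat n C P *\<^sub>v u) i = C u i" .
  define m where "m = nat ((2 * i + 2) mod (2 * int n))"
  have m: "m < 2 * n" using pos_less[OF n] by (simp add: m_def)
  have "(2 * i + 2) mod (2 * int n) = 2 * ((i + 1) mod int n)"
    using mod_mult_mult1[of 2 "i + 1" "int n"] by (simp add: distrib_left del: mod_mult_mult1)
  moreover have "(i + 1) mod int n \<ge> 0" using n by simp
  ultimately have "int m = 2 * ((i + 1) mod int n)" unfolding m_def by simp
  then have *: "\<not> odd m" "int (m div 2) = (i + 1) mod int n" using even_pos by blast+
  have "point_val (stencil_mat n C P *\<^sub>v u) i = (stencil_mat n C P *\<^sub>v u) $ m"
    by (simp only: point_val_def dim m_def of_nat_mult of_nat_numeral)
  also have "\<dots> = P u i"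
    using P u P' * by (simp only: stencil_mat_row[OF m u] lin_fun_def not_False_eq_True not_True_eq_False if_False if_True)
  finally show "point_val (stencil_mat n C P *\<^sub>v u) i = P u i" .
qed

lemma values_periodic_simps:
  assumes "dim_vec u = 2 * n"
  shows "cell_avg u (i mod int n) = cell_avg u i"
    "point_val u (i mod int n) = point_val u i"
    "point_val u (i mod int n - 1) = point_val u (i - 1)"
    "cell_avg u ((i + 1) mod int n - 1) = cell_avg u i"
    "point_val u ((i + 1) mod int n - 1) = point_val u i"
    "cell_avg u ((i + 1) mod int n) = cell_avg u (i + 1)"
    "point_val u ((i + 1) mod int n) = point_val u (i + 1)"
    "point_val u ((i + 1) mod int n - 1 - 1) = point_val u (i - 1)"
    "point_val u ((i + 1) mod int n - 2) = point_val u (i - 1)"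
  using values_periodic[OF assms, of i 0] values_periodic[OF assms, of i "-1"]
    values_periodic[OF assms, of "i + 1" "-1"] values_periodic[OF assms, of "i + 1" 0]
    values_periodic[OF assms, of "i + 1" "-2"]
  by simp_all

lemma D_plus_action:
  assumes "n > 0" "u \<in> carrier_vec (2 * n)"
  shows "cell_avg (D_plus n dx *\<^sub>v u) i = (point_val u i - point_val u (i - 1)) / dx"
    and "point_val (D_plus n dx *\<^sub>v u) i
           = (- 4 * point_val u i + 6 * cell_avg u (i + 1) - 2 * point_val u (i + 1)) / dx"
  unfolding D_plus_def
  by (rule stencil_mat_action[OF assms];
      use assms in \<open>(intro lin_fun_intros; simp) | simp add: values_periodic_simps\<close>)+

lemma D_minus_action:
  assumes "n > 0" "u \<in> carrier_vec (2 * n)"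
  shows "cell_avg (D_minus n dx *\<^sub>v u) i = (point_val u i - point_val u (i - 1)) / dx"
    and "point_val (D_minus n dx *\<^sub>v u) i
           = (2 * point_val u (i - 1) - 6 * cell_avg u i + 4 * point_val u i) / dx"
  unfolding D_minus_def
  by (rule stencil_mat_action[OF assms];
      use assms in \<open>(intro lin_fun_intros; simp) | simp add: values_periodic_simps\<close>)+

lemma mass_mat_action:
  assumes "n > 0" "u \<in> carrier_vec (2 * n)"
  shows "cell_avg (mass_mat n dx mv *\<^sub>v u) i
           = dx * mv * (- 1/2 * point_val u (i - 1) + cell_avg u i - 1/2 * point_val u i)"
    and "point_val (mass_mat n dx mv *\<^sub>v u) i
           = dx * mv * (1/6 * point_val u (i - 1) - 1/2 * cell_avg u i + 2/3 * point_val u i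
                        - 1/2 * cell_avg u (i + 1) + 1/6 * point_val u (i + 1))"
  unfolding mass_mat_def
  by (rule stencil_mat_action[OF assms];
      use assms in \<open>(intro lin_fun_intros; simp) | simp add: values_periodic_simps\<close>)+

end

theory Submission
  imports Defs
begin

text \<open>
  The condition \<open>M D\<^sub>+ + D\<^sub>-\<^sup>T M = 0\<close> is a linear system for the entries of \<open>M\<close> that couples only
  nearby positions. Reading rows and columns as integers modulo \<open>2n\<close> removes all boundary cases:
  multiplication by \<open>D\<^sub>+\<close> from the right, or by \<open>D\<^sub>-\<^sup>T\<close> from the left, replaces an entry by a short
  combination of entries with shifted indices, whose coefficients depend only on the parity of one
  index, that is, on whether it belongs to a cell average (odd) or to a point value (even)
  (\<open>mult_D_plus_entry\<close>, \<open>transpose_D_minus_mult_entry\<close>, combined in \<open>adjoint_iff_entries\<close>).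

  Existence: each entry of the claimed matrix is a combination of periodic Kronecker deltas of the
  index difference. In each of the four parity cases the equation becomes an identity
  between the coefficients of these deltas, so it holds for every \<open>n\<close>, even where
  distinct diagonals wrap onto each other.

  Uniqueness: the equations whose row is a cell average already suffice. If the column is a
  cell average too, then \<open>D\<^sub>+\<close> and \<open>D\<^sub>-\<close> contribute one term each, and the equation moves a
  value one step along the first off-diagonal; so that diagonal is a constant \<open>c\<close>. If the column is
  a point value, the columns at distance -3, 3, -1 and 1 from the row give, in this order, the
  values 0 (second off-diagonal, cells), -c/3 (second off-diagonal, points), -2c (diagonal, cells)
  and -4c/3 (diagonal, points). Hence a solution is determined by \<open>c\<close>
  (\<open>adjoint_determines_entries\<close>), and \<open>mv = -2c/dx\<close> gives the member of the family with the same
  \<open>c\<close>.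

  The bound \<open>n \<ge> 4\<close> enters because the equations with point columns involve entries at distances
  3, 4 and 5 from the diagonal, which must be known to vanish. Such a distance differs from those
  of the five diagonals of the band by at least 1 and at most 7, so it is congruent to none of them
  modulo \<open>2n\<close> once \<open>2n \<ge> 8\<close>.
\<close>

section \<open>Matrix entries at periodic positions\<close>

definition per_entry :: "real mat \<Rightarrow> int \<Rightarrow> int \<Rightarrow> real" where
  "per_entry A x y = A $$ (nat (x mod int (dim_row A)), nat (y mod int (dim_col A)))"

text \<open>The Kronecker delta of the integers modulo \<open>2n\<close>, as a function of the index difference.\<close>

definition wrap_delta :: "nat \<Rightarrow> int \<Rightarrow> real" where
  "wrap_delta n z = of_bool (2 * int n dvd z)"

text \<open>
  The modulus is even, so positions of different kind never coincide. This lets a single formula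
  serve for rows of both kinds in \<open>D_plus_column\<close> and \<open>D_minus_column\<close>.
\<close>

lemma wrap_delta_odd [simp]: "odd z \<Longrightarrow> wrap_delta n z = 0"
  unfolding wrap_delta_def by (auto dest: dvd_mult_left)

lemma wrap_delta_uminus: "wrap_delta n (- z) = wrap_delta n z"
  by (simp add: wrap_delta_def)

lemma wrap_delta_cong: "[z = w] (mod 2 * int n) \<Longrightarrow> wrap_delta n z = wrap_delta n w"
  unfolding wrap_delta_def by (simp add: cong_dvd_iff)

lemma nat_mod_eq_iff:
  assumes "l < 2 * n"
  shows "nat (x mod (2 * int n)) = l \<longleftrightarrow> 2 * int n dvd int l - x"
proof -
  have "nat (x mod (2 * int n)) = l \<longleftrightarrow> x mod (2 * int n) = int l"
    using assms pos_mod_sign[of "2 * int n" x] by auto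
  also have "\<dots> \<longleftrightarrow> x mod (2 * int n) = int l mod (2 * int n)"
    using assms by simp
  also have "\<dots> \<longleftrightarrow> 2 * int n dvd int l - x"
    by (metis mod_eq_dvd_iff)
  finally show ?thesis .
qed

lemma unit_vec_values:
  assumes "l < 2 * n"
  shows "cell_avg (unit_vec (2 * n) l) i = wrap_delta n (int l - (2 * i + 1))"
    and "point_val (unit_vec (2 * n) l) i = wrap_delta n (int l - (2 * i + 2))"
  using assms pos_less[of n]
  by (simp_all add: cell_avg_def point_val_def wrap_delta_def unit_vec_def nat_mod_eq_iff)

lemma sum_wrap_delta:
  assumes "n > 0"
  shows "(\<Sum>j<2 * n. g j * wrap_delta n (int j - z)) = g (nat (z mod (2 * int n)))"
proof -
  have "(\<Sum>j<2 * n. g j * wrap_delta n (int j - z))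
          = (\<Sum>j<2 * n. if nat (z mod (2 * int n)) = j then g j else 0)"
    by (intro sum.cong) (auto simp: wrap_delta_def nat_mod_eq_iff)
  then show ?thesis using pos_less[OF assms] by simp
qed

lemma per_entry_of_nat:
  assumes "A \<in> carrier_mat (2 * n) (2 * n)" "k < 2 * n" "l < 2 * n"
  shows "per_entry A (int k) (int l) = A $$ (k, l)"
  using assms by (auto simp: per_entry_def simp flip: of_nat_mult)

lemma per_entry_cong:
  assumes "A \<in> carrier_mat (2 * n) (2 * n)" "[x = x'] (mod 2 * int n)" "[y = y'] (mod 2 * int n)"
  shows "per_entry A x y = per_entry A x' y'"
  using assms by (auto simp: per_entry_def cong_def)

lemma eq_mat_per_entry:
  assumes "A \<in> carrier_mat (2 * n) (2 * n)" "B \<in> carrier_mat (2 * n) (2 * n)"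
    and "\<And>x y. per_entry A x y = per_entry B x y"
  shows "A = B"
  using assms by (metis carrier_matD eq_matI per_entry_of_nat)

lemma per_entry_transpose:
  assumes "A \<in> carrier_mat (2 * n) (2 * n)" "n > 0"
  shows "per_entry (transpose_mat A) x y = per_entry A y x"
  using assms pos_less[of n] by (auto simp: per_entry_def)

section \<open>Adjointness as equations between entries\<close>

text \<open>
  The product \<open>M D\<^sub>+\<close> sums over the rows of a column of \<open>D\<^sub>+\<close>. Therefore the row stencil is turned
  into a column stencil whose shape depends only on the parity of the column: a cell average is
  used only by the point value to its left, while a point value is used by both adjacent cells,
  by itself and by the point value to its left. Each delta vanishes by parity on the rows that it
  does not concern.
\<close>

lemma D_plus_column:
  assumes "j < 2 * n" "l < 2 * n"
  shows "D_plus n dx $$ (j, l) =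
    (if odd l then 6 * wrap_delta n (int j - (int l - 1))
     else wrap_delta n (int j - (int l - 1)) - wrap_delta n (int j - (int l + 1))
          - 4 * wrap_delta n (int j - int l) - 2 * wrap_delta n (int j - (int l - 2))) / dx"
proof -
  have s: "wrap_delta n (int j - z) = wrap_delta n (z - int j)" for z
    using wrap_delta_uminus[of n "int j - z"] by simp
  show ?thesis
  proof (cases "odd j")
    case True
    then have "2 * int (j div 2) = int j - 1" by presburger
    then show ?thesis
      using assms True
      by (simp add: D_plus_def stencil_mat_def unit_vec_values s; simp add: algebra_simps)
  next
    case False
    then have "2 * int (j div 2) = int j" by presburger
    then show ?thesis
      using assms False
      by (simp add: D_plus_def stencil_mat_def unit_vec_values s; simp add: algebra_simps)
  qed
qed

text \<open>The mirror image: here information is taken from the left, so a value acts to its right.\<close>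

lemma D_minus_column:
  assumes "j < 2 * n" "l < 2 * n"
  shows "D_minus n dx $$ (j, l) =
    (if odd l then - 6 * wrap_delta n (int j - (int l + 1))
     else wrap_delta n (int j - (int l - 1)) - wrap_delta n (int j - (int l + 1))
          + 4 * wrap_delta n (int j - int l) + 2 * wrap_delta n (int j - (int l + 2))) / dx"
proof -
  have s: "wrap_delta n (int j - z) = wrap_delta n (z - int j)" for z
    using wrap_delta_uminus[of n "int j - z"] by simp
  show ?thesis
  proof (cases "odd j")
    case True
    then have "2 * int (j div 2) = int j - 1" by presburger
    then show ?thesis
      using assms True
      by (simp add: D_minus_def stencil_mat_def unit_vec_values s; simp add: algebra_simps)
  next
    case False
    then have "2 * int (j div 2) = int j" by presburger
    then show ?thesis
      using assms False
      by (simp add: D_minus_def stencil_mat_def unit_vec_values s; simp add: algebra_simps)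
  qed
qed

lemma operator_carriers:
  "D_plus n dx \<in> carrier_mat (2 * n) (2 * n)" "D_minus n dx \<in> carrier_mat (2 * n) (2 * n)"
  "mass_mat n dx mv \<in> carrier_mat (2 * n) (2 * n)"
  by (simp_all add: D_plus_def D_minus_def mass_mat_def stencil_mat_carrier)

text \<open>Each delta in a column of \<open>D\<^sub>+\<close> selects one shifted entry of \<open>M\<close>.\<close>

lemma mult_D_plus_entry:
  assumes n: "n > 0" and M: "M \<in> carrier_mat (2 * n) (2 * n)"
  shows "per_entry (M * D_plus n dx) x y =
    (if odd y then 6 * per_entry M x (y - 1)
     else per_entry M x (y - 1) - per_entry M x (y + 1)
          - 4 * per_entry M x y - 2 * per_entry M x (y - 2)) / dx"
proof -
  define k where "k = nat (x mod (2 * int n))"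
  define l where "l = nat (y mod (2 * int n))"
  have kl: "k < 2 * n" "l < 2 * n" using pos_less[OF n] by (simp_all add: k_def l_def)
  have l: "int l = y mod (2 * int n)" using n by (simp add: l_def)
  \<comment> \<open>The kind of a position survives reduction since the modulus is even.\<close>
  have par: "odd l \<longleftrightarrow> odd y"
    by (metis l even_of_nat dvd_mod_iff dvd_triv_left)
  have col: "M $$ (k, nat ((int l + c) mod (2 * int n))) = per_entry M x (y + c)" for c
    using M by (auto simp: per_entry_def k_def l mod_add_left_eq)
  have "per_entry (M * D_plus n dx) x y = (\<Sum>j<2 * n. M $$ (k, j) * D_plus n dx $$ (j, l))"
    using M operator_carriers(1)[of n dx] kl
    by (auto simp: per_entry_def scalar_prod_def atLeast0LessThan simp flip: k_def l_def
             intro!: sum.cong)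
  also have "\<dots> = (\<Sum>j<2 * n. M $$ (k, j) *
      ((if odd l then 6 * wrap_delta n (int j - (int l - 1))
     else wrap_delta n (int j - (int l - 1)) - wrap_delta n (int j - (int l + 1))
          - 4 * wrap_delta n (int j - int l) - 2 * wrap_delta n (int j - (int l - 2))) / dx))"
    using kl by (intro sum.cong) (simp_all add: D_plus_column)
  also have "\<dots> = (let S = (\<lambda>c. \<Sum>j<2 * n. M $$ (k, j) * wrap_delta n (int j - (int l + c))) in
      (if odd l then 6 * S (- 1) else S (- 1) - S 1 - 4 * S 0 - 2 * S (- 2)) / dx)"
    by (auto simp: Let_def sum_distrib_left sum_divide_distrib algebra_simps diff_divide_distrib
          sum_subtractf add_divide_distrib sum.distrib)
  also have "\<dots> = (if odd y then 6 * per_entry M x (y - 1)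
     else per_entry M x (y - 1) - per_entry M x (y + 1)
          - 4 * per_entry M x y - 2 * per_entry M x (y - 2)) / dx"
    unfolding Let_def sum_wrap_delta[OF n] col par by simp
  finally show ?thesis .
qed

lemma transpose_D_minus_mult_entry:
  assumes n: "n > 0" and M: "M \<in> carrier_mat (2 * n) (2 * n)"
  shows "per_entry (transpose_mat (D_minus n dx) * M) x y =
    (if odd x then - 6 * per_entry M (x + 1) y
     else per_entry M (x - 1) y - per_entry M (x + 1) y
          + 4 * per_entry M x y + 2 * per_entry M (x + 2) y) / dx"
proof -
  define k where "k = nat (x mod (2 * int n))"
  define l where "l = nat (y mod (2 * int n))"
  have kl: "k < 2 * n" "l < 2 * n" using pos_less[OF n] by (simp_all add: k_def l_def)
  have k: "int k = x mod (2 * int n)" using n by (simp add: k_def)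
  have par: "odd k \<longleftrightarrow> odd x"
    by (metis k even_of_nat dvd_mod_iff dvd_triv_left)
  have row: "M $$ (nat ((int k + c) mod (2 * int n)), l) = per_entry M (x + c) y" for c
    using M by (auto simp: per_entry_def l_def k mod_add_left_eq)
  have "per_entry (transpose_mat (D_minus n dx) * M) x y
          = (\<Sum>j<2 * n. M $$ (j, l) * D_minus n dx $$ (j, k))"
    using M operator_carriers(2)[of n dx] kl
    by (auto simp: per_entry_def scalar_prod_def atLeast0LessThan simp flip: k_def l_def
             intro!: sum.cong)
  also have "\<dots> = (\<Sum>j<2 * n. M $$ (j, l) *
      ((if odd k then - 6 * wrap_delta n (int j - (int k + 1))
     else wrap_delta n (int j - (int k - 1)) - wrap_delta n (int j - (int k + 1))
          + 4 * wrap_delta n (int j - int k) + 2 * wrap_delta n (int j - (int k + 2))) / dx))"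
    using kl by (intro sum.cong) (simp_all add: D_minus_column)
  also have "\<dots> = (let S = (\<lambda>c. \<Sum>j<2 * n. M $$ (j, l) * wrap_delta n (int j - (int k + c))) in
      (if odd k then - 6 * S 1 else S (- 1) - S 1 + 4 * S 0 + 2 * S 2) / dx)"
    by (auto simp: Let_def sum_distrib_left sum_divide_distrib algebra_simps diff_divide_distrib
          sum_subtractf add_divide_distrib sum.distrib sum_negf)
  also have "\<dots> = (if odd x then - 6 * per_entry M (x + 1) y
     else per_entry M (x - 1) y - per_entry M (x + 1) y
          + 4 * per_entry M x y + 2 * per_entry M (x + 2) y) / dx"
    unfolding Let_def sum_wrap_delta[OF n] row par by simp
  finally show ?thesis .
qed

text \<open>
  Here \<open>x\<close> and \<open>y\<close> range over all integers, so the equations can be shifted freely without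
  regard to the ends of the vector of unknowns.
\<close>

lemma adjoint_iff_entries:
  assumes n: "n > 0" and dx: "dx \<noteq> 0" and M: "M \<in> carrier_mat (2 * n) (2 * n)"
  shows "M * D_plus n dx + transpose_mat (D_minus n dx) * M = 0\<^sub>m (2 * n) (2 * n) \<longleftrightarrow>
    (\<forall>x y. (if odd y then 6 * per_entry M x (y - 1)
            else per_entry M x (y - 1) - per_entry M x (y + 1)
                 - 4 * per_entry M x y - 2 * per_entry M x (y - 2))
         + (if odd x then - 6 * per_entry M (x + 1) y
            else per_entry M (x - 1) y - per_entry M (x + 1) y
                 + 4 * per_entry M x y + 2 * per_entry M (x + 2) y) = 0)"
    (is "?A + ?B = _ \<longleftrightarrow> (\<forall>x y. ?p x y + ?q x y = 0)")
proof -
  have C: "?A \<in> carrier_mat (2 * n) (2 * n)" "?B \<in> carrier_mat (2 * n) (2 * n)"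
    using M operator_carriers(1,2)[of n dx] by auto
  have "per_entry (?A + ?B) x y = per_entry ?A x y + per_entry ?B x y" for x y
    using C pos_less[OF n] M operator_carriers(1,2)[of n dx] by (auto simp: per_entry_def)
  then have sum: "per_entry (?A + ?B) x y = (?p x y + ?q x y) / dx" for x y
    by (simp only: mult_D_plus_entry[OF n M] transpose_D_minus_mult_entry[OF n M]
          add_divide_distrib)
  have zero: "per_entry (0\<^sub>m (2 * n) (2 * n)) x y = 0" for x y
    using pos_less[OF n] by (simp add: per_entry_def)
  have "?A + ?B = 0\<^sub>m (2 * n) (2 * n) \<longleftrightarrow> (\<forall>x y. per_entry (?A + ?B) x y = 0)"
  proof
    assume "?A + ?B = 0\<^sub>m (2 * n) (2 * n)"
    then show "\<forall>x y. per_entry (?A + ?B) x y = 0" using zero by simp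
  next
    assume "\<forall>x y. per_entry (?A + ?B) x y = 0"
    then show "?A + ?B = 0\<^sub>m (2 * n) (2 * n)"
      using C zero by (intro eq_mat_per_entry[of _ n]) auto
  qed
  also have "\<dots> \<longleftrightarrow> (\<forall>x y. ?p x y + ?q x y = 0)"
    unfolding sum using dx by simp
  finally show ?thesis .
qed

section \<open>The mass matrices are solutions\<close>

lemma per_entry_mass_mat:
  assumes n: "n > 0"
  shows "per_entry (mass_mat n dx mv) x y = dx * mv *
    (if odd x then - 1/2 * wrap_delta n (y - x + 1) + wrap_delta n (y - x)
                   - 1/2 * wrap_delta n (y - x - 1)
     else 1/6 * wrap_delta n (y - x + 2) - 1/2 * wrap_delta n (y - x + 1)
          + 2/3 * wrap_delta n (y - x) - 1/2 * wrap_delta n (y - x - 1)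
          + 1/6 * wrap_delta n (y - x - 2))"
proof -
  define k where "k = nat (x mod (2 * int n))"
  define l where "l = nat (y mod (2 * int n))"
  have kl: "k < 2 * n" "l < 2 * n" using pos_less[OF n] by (simp_all add: k_def l_def)
  have k: "int k = x mod (2 * int n)" and l: "int l = y mod (2 * int n)"
    using n by (simp_all add: k_def l_def)
  have par: "odd k \<longleftrightarrow> odd x"
    by (metis k even_of_nat dvd_mod_iff dvd_triv_left)
  have shift: "wrap_delta n (y - x + c) = wrap_delta n (int l - int k + c)" for c
    by (rule wrap_delta_cong) (unfold k l cong_def, metis mod_add_left_eq mod_diff_eq)
  have shifts: "wrap_delta n (y - x) = wrap_delta n (int l - int k)"
    "wrap_delta n (y - x - 1) = wrap_delta n (int l - int k - 1)"
    "wrap_delta n (y - x - 2) = wrap_delta n (int l - int k - 2)"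
    using shift[of 0] shift[of "- 1"] shift[of "- 2"] by simp_all
  have "per_entry (mass_mat n dx mv) x y = mass_mat n dx mv $$ (k, l)"
    using operator_carriers(3)[of n dx mv] by (auto simp: per_entry_def k_def l_def)
  also have "\<dots> = dx * mv *
    (if odd k then - 1/2 * wrap_delta n (int l - int k + 1) + wrap_delta n (int l - int k)
                   - 1/2 * wrap_delta n (int l - int k - 1)
     else 1/6 * wrap_delta n (int l - int k + 2) - 1/2 * wrap_delta n (int l - int k + 1)
          + 2/3 * wrap_delta n (int l - int k) - 1/2 * wrap_delta n (int l - int k - 1)
          + 1/6 * wrap_delta n (int l - int k - 2))"
  proof (cases "odd k")
    case True
    then have "2 * int (k div 2) = int k - 1" by presburger
    then show ?thesis
      using kl True by (simp add: mass_mat_def stencil_mat_def unit_vec_values; simp add: algebra_simps)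
  next
    case False
    then have "2 * int (k div 2) = int k" by presburger
    then show ?thesis
      using kl False by (simp add: mass_mat_def stencil_mat_def unit_vec_values; simp add: algebra_simps)
  qed
  finally show ?thesis unfolding par shift shifts .
qed

lemma mass_mat_symmetric:
  assumes n: "n > 0"
  shows "transpose_mat (mass_mat n dx mv) = mass_mat n dx mv"
proof (rule eq_mat_per_entry[of _ n])
  fix x y
  \<comment> \<open>Transposition negates the index difference; the deltas are brought back to \<open>y - x\<close>.\<close>
  have flip: "wrap_delta n (x - y + c) = wrap_delta n (y - x - c)" for c
    using wrap_delta_uminus[of n "x - y + c"] by (simp add: algebra_simps)
  have flips: "wrap_delta n (x - y) = wrap_delta n (y - x)"
    "wrap_delta n (x - y - 1) = wrap_delta n (y - x + 1)"
    "wrap_delta n (x - y - 2) = wrap_delta n (y - x + 2)"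
    using flip[of 0] flip[of "- 1"] flip[of "- 2"] by simp_all
  have "per_entry (mass_mat n dx mv) y x = per_entry (mass_mat n dx mv) x y"
    by (cases "odd x"; cases "odd y") (simp_all add: per_entry_mass_mat[OF n] flip flips)
  then show "per_entry (transpose_mat (mass_mat n dx mv)) x y = per_entry (mass_mat n dx mv) x y"
    by (simp add: per_entry_transpose[OF operator_carriers(3) n])
qed (simp_all add: operator_carriers)

lemma mass_mat_pentadiagonal:
  assumes n: "n > 0"
  shows "periodic_pentadiagonal n (mass_mat n dx mv)"
  unfolding periodic_pentadiagonal_def
proof (intro allI impI)
  fix k l
  assume kl: "k < 2 * n" "l < 2 * n"
    and far: "\<forall>d \<in> {0, 1, -1, 2, -2}. \<not> [int k - int l = d] (mod 2 * int n)"
  have "wrap_delta n (int l - int k + d) = 0" if "d \<in> {0, 1, -1, 2, -2}" for d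
  proof -
    have "\<not> 2 * int n dvd int k - int l - d"
      using far that by (auto simp: cong_iff_dvd_diff)
    then show ?thesis
      using wrap_delta_uminus[of n "int k - int l - d"]
      by (simp add: wrap_delta_def algebra_simps)
  qed
  from this[of 0] this[of 1] this[of "-1"] this[of 2] this[of "-2"]
  show "mass_mat n dx mv $$ (k, l) = 0"
    by (simp add: per_entry_mass_mat[OF n] flip: per_entry_of_nat[OF operator_carriers(3) kl])
qed

text \<open>
  Every term depends on the column only through its difference to the row. For each choice of the
  two parities the coefficients of every delta cancel.
\<close>

lemma mass_mat_adjoint:
  assumes n: "n > 0" and dx: "dx \<noteq> 0"
  shows "mass_mat n dx mv * D_plus n dx + transpose_mat (D_minus n dx) * mass_mat n dx mv
           = 0\<^sub>m (2 * n) (2 * n)"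
  unfolding adjoint_iff_entries[OF n dx operator_carriers(3)] per_entry_mass_mat[OF n]
proof (intro allI, goal_cases)
  case (1 x y)
  define d where "d = y - x"
  have y: "y = x + d" by (simp add: d_def)
  show ?case
    unfolding y by (cases "odd x"; cases "odd d") (simp_all add: algebra_simps)
qed

section \<open>Uniqueness up to a scalar\<close>

lemma per_entry_far:
  assumes n: "n > 0" and M: "M \<in> carrier_mat (2 * n) (2 * n)" and P: "periodic_pentadiagonal n M"
    and far: "\<And>d. d \<in> {-2..2} \<Longrightarrow> \<not> [y - x = d] (mod 2 * int n)"
  shows "per_entry M x y = 0"
proof -
  define k where "k = nat (x mod (2 * int n))"
  define l where "l = nat (y mod (2 * int n))"
  have kl: "k < 2 * n" "l < 2 * n" using pos_less[OF n] by (simp_all add: k_def l_def)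
  have k: "int k = x mod (2 * int n)" and l: "int l = y mod (2 * int n)"
    using n by (simp_all add: k_def l_def)
  have "\<not> [int k - int l = d] (mod 2 * int n)" if "d \<in> {0, 1, -1, 2, -2}" for d
  proof
    assume "[int k - int l = d] (mod 2 * int n)"
    then have "[- (x - y) = - d] (mod 2 * int n)"
      by (simp only: cong_minus_minus_iff) (simp add: k l cong_def mod_simps)
    then show False using far[of "- d"] that by auto
  qed
  then have "M $$ (k, l) = 0"
    using P kl by (auto simp: periodic_pentadiagonal_def)
  then show ?thesis using M by (auto simp: per_entry_def k_def l_def)
qed

text \<open>
  For large enough grids the diagonals at distance 3, 4 and 5 are not aliases of the five
  diagonals that carry entries; on three cells, 4 would wrap onto -2 and 5 onto -1.
\<close>

lemma per_entry_gap:
  assumes n: "n \<ge> 4" and M: "M \<in> carrier_mat (2 * n) (2 * n)" and P: "periodic_pentadiagonal n M"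
    and gap: "3 \<le> \<bar>y - x\<bar>" "\<bar>y - x\<bar> \<le> 5"
  shows "per_entry M x y = 0"
proof (rule per_entry_far[OF _ M P])
  show "n > 0" using n by simp
  fix d :: int
  assume d: "d \<in> {-2..2}"
  show "\<not> [y - x = d] (mod 2 * int n)"
  proof
    assume "[y - x = d] (mod 2 * int n)"
    then have "2 * int n dvd y - x - d" by (simp add: cong_iff_dvd_diff)
    then have "\<bar>2 * int n\<bar> \<le> \<bar>y - x - d\<bar>"
      using gap d by (intro dvd_imp_le_int) auto
    then show False using gap d n by auto
  qed
qed

text \<open>
  The local equations are solved in an order in which each one contains a single new unknown; the
  value of one entry of the first off-diagonal is the remaining freedom.
\<close>

lemma adjoint_determines_entries:
  assumes n: "n \<ge> 4" and dx: "dx \<noteq> 0" and M: "M \<in> carrier_mat (2 * n) (2 * n)"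
    and sym: "transpose_mat M = M" and P: "periodic_pentadiagonal n M"
    and adj: "M * D_plus n dx + transpose_mat (D_minus n dx) * M = 0\<^sub>m (2 * n) (2 * n)"
  shows "per_entry M x (x + 1) = per_entry M 0 1"
    and "per_entry M x x = (if odd x then - 2 else - 4/3) * per_entry M 0 1"
    and "per_entry M x (x + 2) = (if odd x then 0 else - 1/3) * per_entry M 0 1"
proof -
  let ?c = "per_entry M 0 1"
  have n0: "n > 0" using n by simp
  have swap: "per_entry M x y = per_entry M y x" for x y
    using per_entry_transpose[OF M n0, of y x] sym by simp
  note eqs = adj[unfolded adjoint_iff_entries[OF n0 dx M], rule_format]
  note gap = per_entry_gap[OF n M P]
  have cell_cell: "per_entry M x (y - 1) = per_entry M (x + 1) y" if "odd x" "odd y" for x y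
    using eqs[where x=x and y=y] that by simp
  have cell_point: "per_entry M x (y - 1) - per_entry M x (y + 1) - 4 * per_entry M x y
      - 2 * per_entry M x (y - 2) - 6 * per_entry M (x + 1) y = 0" if "odd x" "even y" for x y
    using eqs[where x=x and y=y] that by simp
  \<comment> \<open>Equations at distance 2 (\<open>x\<close> a cell) and 0 (\<open>x\<close> a point) move along the first off-diagonal.\<close>
  have step: "per_entry M x (x + 1) = per_entry M (x + 1) (x + 1 + 1)" for x
  proof (cases "odd x")
    case True
    then show ?thesis using cell_cell[of x "x + 2"] by (simp add: add.commute)
  next
    case False
    then show ?thesis
      using cell_cell[of "x + 1" "x + 1"] swap[of "x + 1" x] swap[of "x + 2" "x + 1"]
      by (simp add: add.commute)
  qed
  have off1: "per_entry M x (x + 1) = ?c" for x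
  proof (induction x rule: int_induct[where k = 0])
    case base
    show ?case by simp
  next
    case (step1 i)
    then show ?case using step[of i] by simp
  next
    case (step2 i)
    then show ?case using step[of "i - 1"] by simp
  qed
  have off1': "per_entry M (x + 1) x = ?c" for x
    using off1[of x] swap by simp
  \<comment> \<open>At distance -3 all other entries lie outside the band, which leaves only \<open>M x (x - 2)\<close>.\<close>
  have cell2: "per_entry M x (x - 2) = 0" if "odd x" for x
    using cell_point[of x "x - 3"] that gap[of "x - 3" x] gap[of "x - 5" x] gap[of "x - 4" x]
      gap[of "x - 3" "x + 1"] by simp
  have cell2': "per_entry M x (x + 2) = 0" if "odd x" for x
    using cell2[of "x + 2"] swap[of "x + 2" x] that by simp
  \<comment> \<open>Distance 3 from the cell \<open>x - 1\<close>.\<close>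
  have point2: "per_entry M x (x + 2) = - 1/3 * ?c" if "even x" for x
    using cell_point[of "x - 1" "x + 2"] that gap[of "x + 2" "x - 1"] gap[of "x + 3" "x - 1"]
      off1[of "x - 1"] cell2'[of "x - 1"] by (simp add: add.commute)
  \<comment> \<open>Distance -1, where the point diagonal does not occur: \<open>- M x x - 4 c + 2 c = 0\<close>.\<close>
  have cell0: "per_entry M x x = - 2 * ?c" if "odd x" for x
    using cell_point[of x "x - 1"] that gap[of "x - 3" x] off1'[of "x - 1"] cell2[of x]
      swap[of "x + 1" "x - 1"] point2[of "x - 1"] by (simp add: add.commute)
  \<comment> \<open>Distance 1 from the cell \<open>x - 1\<close>, now that its own diagonal entry is known.\<close>
  have point0: "per_entry M x x = - 4/3 * ?c" if "even x" for x
    using cell_point[of "x - 1" x] that off1[of "x - 1"] off1'[of "x - 2"]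
      cell0[of "x - 1"] cell2'[of "x - 1"] by (simp add: add.commute)
  show "per_entry M x (x + 1) = ?c" by (rule off1)
  show "per_entry M x x = (if odd x then - 2 else - 4/3) * ?c"
    using cell0 point0 by simp
  show "per_entry M x (x + 2) = (if odd x then 0 else - 1/3) * ?c"
    using cell2' point2 by simp
qed

lemma adjoint_solution_unique:
  assumes n: "n \<ge> 4" and dx: "dx \<noteq> 0"
    and M: "M \<in> carrier_mat (2 * n) (2 * n)" "transpose_mat M = M" "periodic_pentadiagonal n M"
      "M * D_plus n dx + transpose_mat (D_minus n dx) * M = 0\<^sub>m (2 * n) (2 * n)"
    and N: "N \<in> carrier_mat (2 * n) (2 * n)" "transpose_mat N = N" "periodic_pentadiagonal n N"
      "N * D_plus n dx + transpose_mat (D_minus n dx) * N = 0\<^sub>m (2 * n) (2 * n)"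
    and c: "per_entry M 0 1 = per_entry N 0 1"
  shows "M = N"
proof (rule eq_mat_per_entry[OF M(1) N(1)])
  fix x y
  have n0: "n > 0" using n by simp
  note EM = adjoint_determines_entries[OF n dx M] and EN = adjoint_determines_entries[OF n dx N]
  have swap: "per_entry M x y = per_entry M y x" "per_entry N x y = per_entry N y x" for x y
    using per_entry_transpose[OF M(1) n0, of y x] per_entry_transpose[OF N(1) n0, of y x] M(2) N(2)
    by simp_all
  have upper: "per_entry M x (x + d) = per_entry N x (x + d)" if "d \<in> {0, 1, 2}" for x d
    using that EM[of x] EN[of x] c by auto
  show "per_entry M x y = per_entry N x y"
  proof (cases "\<exists>d \<in> {-2..2}. [y - x = d] (mod 2 * int n)")
    case True
    then obtain d where d: "d \<in> {-2..2}" "[y - x = d] (mod 2 * int n)" by blast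
    have y: "[y = x + d] (mod 2 * int n)"
      using d(2) by (simp add: cong_iff_dvd_diff algebra_simps)
    have "per_entry M x (x + d) = per_entry N x (x + d)"
    proof (cases "d \<ge> 0")
      case True
      then have "d \<in> {0, 1, 2}" using d(1) by auto
      then show ?thesis by (rule upper)
    next
      case False
      then have "- d \<in> {0, 1, 2}" using d(1) by auto
      from upper[OF this, of "x + d"] show ?thesis
        using swap[of x "x + d"] by simp
    qed
    then show ?thesis
      using per_entry_cong[OF M(1) cong_refl y] per_entry_cong[OF N(1) cong_refl y] by simp
  next
    case False
    then show ?thesis
      using per_entry_far[OF n0 M(1,3)] per_entry_far[OF n0 N(1,3)] by metis
  qed
qed

theorem lemma3p7:
  fixes n :: nat and dx :: real
  assumes "n \<ge> 1" and "dx > 0"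
  shows "(\<forall>mv. mass_mat n dx mv \<in> carrier_mat (2 * n) (2 * n) \<and>
               transpose_mat (mass_mat n dx mv) = mass_mat n dx mv \<and>
               periodic_pentadiagonal n (mass_mat n dx mv) \<and>
               mass_mat n dx mv * D_plus n dx + transpose_mat (D_minus n dx) * mass_mat n dx mv
                 = 0\<^sub>m (2 * n) (2 * n)) \<and>
         (n \<ge> 4 \<longrightarrow>
           (\<forall>M \<in> carrier_mat (2 * n) (2 * n).
               transpose_mat M = M \<and>
               periodic_pentadiagonal n M \<and>
               M * D_plus n dx + transpose_mat (D_minus n dx) * M = 0\<^sub>m (2 * n) (2 * n)
               \<longrightarrow> (\<exists>mv. M = mass_mat n dx mv)))"
proof (intro conjI allI impI ballI)
  have n0: "n > 0" and dx0: "dx \<noteq> 0" using assms by simp_all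
  fix mv
  show "mass_mat n dx mv \<in> carrier_mat (2 * n) (2 * n)"
    by (rule operator_carriers)
  show "transpose_mat (mass_mat n dx mv) = mass_mat n dx mv"
    by (rule mass_mat_symmetric[OF n0])
  show "periodic_pentadiagonal n (mass_mat n dx mv)"
    by (rule mass_mat_pentadiagonal[OF n0])
  show "mass_mat n dx mv * D_plus n dx + transpose_mat (D_minus n dx) * mass_mat n dx mv
          = 0\<^sub>m (2 * n) (2 * n)"
    by (rule mass_mat_adjoint[OF n0 dx0])
next
  have n0: "n > 0" and dx0: "dx \<noteq> 0" using assms by simp_all
  fix M
  assume n: "n \<ge> 4" and M: "M \<in> carrier_mat (2 * n) (2 * n)"
    and hyp: "transpose_mat M = M \<and> periodic_pentadiagonal n M \<and>
      M * D_plus n dx + transpose_mat (D_minus n dx) * M = 0\<^sub>m (2 * n) (2 * n)"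
  \<comment> \<open>The first off-diagonal of the mass matrix is \<open>- dx mv / 2\<close>.\<close>
  define mv where "mv = - 2 * per_entry M 0 1 / dx"
  have "\<not> 2 * int n dvd 2"
    using n zdvd_imp_le[of "2 * int n" 2] by linarith
  \<comment> \<open>The entry next to the diagonal also meets the delta of the other neighbour, at difference 2.\<close>
  then have "per_entry (mass_mat n dx mv) 0 1 = - 1/2 * (dx * mv)"
    by (simp add: per_entry_mass_mat[OF n0]) (simp add: wrap_delta_def)
  then have "per_entry M 0 1 = per_entry (mass_mat n dx mv) 0 1"
    using dx0 by (simp add: mv_def)
  then have "M = mass_mat n dx mv"
    using hyp operator_carriers(3) mass_mat_symmetric[OF n0] mass_mat_pentadiagonal[OF n0]
      mass_mat_adjoint[OF n0 dx0] adjoint_solution_unique[OF n dx0 M]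
    by blast
  then show "\<exists>mv. M = mass_mat n dx mv" by blast
qed

end
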